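(* Let $f:\mathbb{R}^n\to\mathbb{R}^n$ be a convex monotone homogeneous map that has an eigenvector and has a unique critical class. Then the eigenvector of $f$ is unique up to an additive constant: if $v,v'$ are eigenvectors of $f$, then $v'=\mu+v$ for some $\mu\in\mathbb{R}$.
   Context: $\leq$ is the entrywise order of $\mathbb{R}^n$ and $\lambda+x=(\lambda+x_1,\dots,\lambda+x_n)$. A map $f$ is monotone if $x\le y\Rightarrow f(x)\le f(y)$, (additively) homogeneous if $f(\lambda+x)=\lambda+f(x)$ for all $\lambda\in\mathbb{R}$, and convex if each coordinate is convex. An eigenvector is $v\in\mathbb{R}^n$ with $f(v)=\lambda+v$ for some $\lambda\in\mathbb{R}$ (the eigenvalue $\lambda$ is unique). Let $v$ be an eigenvector of $f$ and $\partial f(v)=\{P\in\mathbb{R}^{n\times n}\mid f(x)-f(v)\ge P(x-v)\ \forall x\}$, whose elements are stochastic matrices. For a stochastic matrix $P$, $\mathscr{G}(P)$ is the directed graph on $\{1,\dots,n\}$ with arcs $i\to j$ when $P_{ij}\neq0$; its classes are the equivalence classes for mutual accessibility (each node has access to itself), a class is final if no node in it has access to a node outside it, and $\mathscr{G}^{f}(P)$ is the restriction of $\mathscr{G}(P)$ to the union of the final classes. The critical graph is $\mathscr{G}^{c}(f)=\bigcup_{P\in\partial f(v)}\mathscr{G}^{f}(P)$; it does not depend on the choice of the eigenvector $v$. The critical classes of $f$ are the node sets of the strongly connected components of $\mathscr{G}^{c}(f)$. *)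

theory Defs
  imports "Graph_Theory.Digraph_Component" "HOL-Analysis.Analysis"
begin

text \<open>
  The coordinates of \<open>\<real>\<^sup>n\<close> and the nodes of all graphs are the elements of a finite type \<open>'n\<close>.
  The order on \<open>real ^ 'n\<close> is the entrywise one, and \<open>\<lambda> + x\<close> is written \<open>vec \<lambda> + x\<close>.
\<close>

definition additively_homogeneous :: "(real ^ 'n \<Rightarrow> real ^ 'n) \<Rightarrow> bool" where
  "additively_homogeneous f \<longleftrightarrow> (\<forall>l x. f (vec l + x) = vec l + f x)"

definition coordinatewise_convex :: "(real ^ 'n::finite \<Rightarrow> real ^ 'n) \<Rightarrow> bool" where
  "coordinatewise_convex f \<longleftrightarrow> (\<forall>i. convex_on UNIV (\<lambda>x. f x $ i))"

definition eigenvector :: "(real ^ 'n \<Rightarrow> real ^ 'n) \<Rightarrow> real ^ 'n \<Rightarrow> bool" where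
  "eigenvector f v \<longleftrightarrow> (\<exists>l. f v = vec l + v)"

definition subdifferential ::
    "(real ^ 'n::finite \<Rightarrow> real ^ 'n) \<Rightarrow> real ^ 'n \<Rightarrow> (real ^ 'n ^ 'n) set" where
  "subdifferential f v = {P. \<forall>x. P *v (x - v) \<le> f x - f v}"

definition matrix_graph :: "real ^ 'n ^ 'n \<Rightarrow> ('n, 'n \<times> 'n) pre_digraph" where
  "matrix_graph P =
    \<lparr> verts = UNIV, arcs = {(i, j). P $ i $ j \<noteq> 0}, tail = fst, head = snd \<rparr>"

text \<open>
  \<^const>\<open>pre_digraph.scc_of\<close> maps a node to its class for mutual accessibility.
\<close>

definition graph_classes :: "('a, 'b) pre_digraph \<Rightarrow> 'a set set" where
  "graph_classes G = pre_digraph.scc_of G ` verts G"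

definition final_classes :: "('a, 'b) pre_digraph \<Rightarrow> 'a set set" where
  "final_classes G = {C \<in> graph_classes G. \<forall>i\<in>C. \<forall>j. i \<rightarrow>\<^sup>*\<^bsub>G\<^esub> j \<longrightarrow> j \<in> C}"

definition final_graph :: "real ^ 'n ^ 'n \<Rightarrow> ('n, 'n \<times> 'n) pre_digraph" where
  "final_graph P = matrix_graph P \<restriction> \<Union> (final_classes (matrix_graph P))"

text \<open>
  The critical graph of \<open>f\<close> is formed at an eigenvector \<open>v\<close>. It is the same graph for every
  eigenvector, so \<open>v\<close> is kept as a parameter instead of being selected by a choice operator.
\<close>

definition critical_graph ::
    "(real ^ 'n::finite \<Rightarrow> real ^ 'n) \<Rightarrow> real ^ 'n \<Rightarrow> ('n, 'n \<times> 'n) pre_digraph" where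
  "critical_graph f v =
    \<lparr> verts = (\<Union>P\<in>subdifferential f v. verts (final_graph P)),
      arcs = (\<Union>P\<in>subdifferential f v. arcs (final_graph P)),
      tail = fst, head = snd \<rparr>"

definition critical_classes ::
    "(real ^ 'n::finite \<Rightarrow> real ^ 'n) \<Rightarrow> real ^ 'n \<Rightarrow> 'n set set" where
  "critical_classes f v = verts ` pre_digraph.sccs (critical_graph f v)"

text \<open>
  \<^const>\<open>pre_digraph.sccs\<close> is meaningful only for well-formed digraphs.
\<close>

lemma wf_digraph_critical_graph: "wf_digraph (critical_graph f v)"
  by unfold_locales
    (auto simp: critical_graph_def final_graph_def matrix_graph_def induce_subgraph_def)

end

theory Submission
  imports Defs
begin

text \<open>
  Let \<open>z\<close> be the difference of two eigenvectors \<open>v\<close> and \<open>w\<close>. Every \<open>P\<close> in the subdifferential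
  at \<open>w\<close> satisfies \<open>P z \<le> z\<close>, so by the minimum principle \<open>z\<close> is constant on the final classes of
  \<open>P\<close>, and it attains its minimum on one of them. Hence \<open>z\<close> is constant on each critical class, and
  the minimum is attained at a critical node. Exchanging \<open>v\<close> and \<open>w\<close>, the maximum of \<open>z\<close> is
  attained on a final class \<open>C\<close> of some \<open>Q\<close> in the subdifferential at \<open>v\<close>; as \<open>z\<close> is constant on
  \<open>C\<close>, the rows of \<open>Q\<close> indexed by \<open>C\<close> are subgradients at \<open>w\<close> as well, so \<open>C\<close> consists of critical
  nodes at \<open>w\<close>. If there is only one critical class, the minimum and the maximum of \<open>z\<close> coincide.
\<close>

section \<open>Subgradients\<close>

text \<open>A hyperplane with normal \<open>(q, s)\<close> separates \<open>(w, g w)\<close> from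
  the strict epigraph of \<open>g\<close>. It is not vertical, so its slope \<open>- q / s\<close>
  is a subgradient.\<close>

lemma convex_on_subgradient_exists:
  fixes g :: "'a::euclidean_space \<Rightarrow> real"
  assumes "convex_on UNIV g"
  obtains p where "\<And>x. p \<bullet> (x - w) \<le> g x - g w"
proof -
  define T where "T = {(x, t). g x < t}"
  have "convex T"
  proof (rule convexI)
    fix y z :: "'a \<times> real" and a b :: real
    assume *: "y \<in> T" "z \<in> T" "0 \<le> a" "0 \<le> b" "a + b = 1"
    obtain y1 y2 z1 z2 where yz: "y = (y1, y2)" "z = (z1, z2)"
      by fastforce
    have "g (a *\<^sub>R y1 + b *\<^sub>R z1) \<le> a * g y1 + b * g z1"
      using assms * by (simp add: convex_on_def)
    also have "\<dots> < a * y2 + b * z2"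
    \<comment> \<open>Strictness comes from a term with positive weight: the first one if
      \<open>a\<close> is nonzero, otherwise the second, as then \<open>b = 1\<close>.\<close>
    proof (cases "a = 0")
      case True
      then show ?thesis using * by (simp add: yz T_def)
    next
      case False
      with * have "a * g y1 < a * y2" "b * g z1 \<le> b * z2"
        by (simp_all add: yz T_def mult_left_mono)
      then show ?thesis by simp
    qed
    finally show "a *\<^sub>R y + b *\<^sub>R z \<in> T"
      by (simp add: yz T_def)
  qed
  moreover have "T \<noteq> {}" "{(w, g w)} \<inter> T = {}"
    by (auto simp: T_def intro!: exI[of _ w] exI[of _ "g w + 1"])
  ultimately obtain c b where c: "c \<noteq> 0" "c \<bullet> (w, g w) \<le> b" "\<forall>y\<in>T. b \<le> c \<bullet> y"
    using separating_hyperplane_sets[of "{(w, g w)}" T]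
    by (metis convex_singleton insertI1 insert_not_empty)
  obtain q s where qs: "c = (q, s)"
    by fastforce
  have sep: "q \<bullet> w + s * g w \<le> q \<bullet> x + s * t" if "g x < t" for x t
    using c that by (fastforce simp: qs T_def)
  have "s > 0"
  proof -
    have "s \<ge> 0"
      using sep[of w "g w + 1"] by (simp add: algebra_simps)
    moreover have "s \<noteq> 0"
    proof
      assume "s = 0"
      \<comment> \<open>Since \<open>g\<close> is finite everywhere, the epigraph has points above
        \<open>w - q\<close>, which lies on the wrong side of a vertical hyperplane.\<close>
      then have "q \<bullet> w \<le> q \<bullet> (w - q)"
        using sep[of "w - q" "g (w - q) + 1"] by simp
      then have "q \<bullet> q \<le> 0"
        by (simp add: inner_diff_right)
      then have "q = 0"
        by (meson inner_gt_zero_iff not_less)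
      with \<open>s = 0\<close> c(1) show False
        by (simp add: qs zero_prod_def)
    qed
    ultimately show ?thesis by simp
  qed
  have "((- 1 / s) *\<^sub>R q) \<bullet> (x - w) \<le> g x - g w" for x
  \<comment> \<open>The separation speaks only of points strictly above the graph, so the graph
    itself is approached from above.\<close>
  proof (rule field_le_epsilon)
    fix e :: real
    assume "0 < e"
    then have "q \<bullet> w + s * g w \<le> q \<bullet> x + s * (g x + e)"
      by (intro sep) simp
    with \<open>s > 0\<close> show "((- 1 / s) *\<^sub>R q) \<bullet> (x - w) \<le> g x - g w + e"
      by (simp add: field_simps inner_diff_right)
  qed
  then show ?thesis by (rule that)
qed

text \<open>The condition decouples over the rows, so elements of the subdifferential can be
  assembled row by row.\<close>

lemma subdifferential_iff_rows:
  "P \<in> subdifferential f v \<longleftrightarrow> (\<forall>i x. P $ i \<bullet> (x - v) \<le> f x $ i - f v $ i)"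
  by (auto simp: subdifferential_def less_eq_vec_def matrix_mult_dot)

lemma subdifferential_nonempty:
  assumes "coordinatewise_convex f"
  shows "subdifferential f v \<noteq> {}"
proof -
  have "\<exists>p. \<forall>x. p \<bullet> (x - v) \<le> f x $ i - f v $ i" for i
    using assms convex_on_subgradient_exists[of "\<lambda>x. f x $ i" v]
    unfolding coordinatewise_convex_def by metis
  then obtain p where "\<forall>i x. p i \<bullet> (x - v) \<le> f x $ i - f v $ i"
    by metis
  then have "(\<chi> i. p i) \<in> subdifferential f v"
    by (simp add: subdifferential_iff_rows)
  then show ?thesis by blast
qed

definition stochastic_matrix :: "real ^ 'n ^ 'n \<Rightarrow> bool" where
  "stochastic_matrix P \<longleftrightarrow> (\<forall>i j. 0 \<le> P $ i $ j) \<and> (\<forall>i. (\<Sum>j\<in>UNIV. P $ i $ j) = 1)"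

text \<open>Lowering coordinate \<open>j\<close> of \<open>v\<close> and using monotonicity gives
  the sign of the entries; shifting \<open>v\<close> by the constants 1 and -1 and using homogeneity
  bounds the row sums from both sides.\<close>

lemma subdifferential_stochastic:
  assumes "mono f" and "additively_homogeneous f" and "P \<in> subdifferential f v"
  shows "stochastic_matrix P"
  unfolding stochastic_matrix_def
proof (intro conjI allI)
  fix i j
  have "f (v - axis j 1) \<le> f v"
    using \<open>mono f\<close> by (rule monoD) (simp add: less_eq_vec_def axis_def)
  moreover have "P $ i \<bullet> (v - axis j 1 - v) \<le> f (v - axis j 1) $ i - f v $ i"
    using assms(3) by (simp only: subdifferential_iff_rows)
  ultimately show "0 \<le> P $ i $ j"
    by (simp add: less_eq_vec_def inner_axis) (meson diff_le_0_iff_le order_trans neg_le_0_iff_le)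
next
  fix i
  have "l * (\<Sum>j\<in>UNIV. P $ i $ j) \<le> l" for l
  proof -
    have "P $ i \<bullet> (vec l + v - v) \<le> f (vec l + v) $ i - f v $ i"
      using assms(3) by (simp only: subdifferential_iff_rows)
    then show ?thesis
      using assms(2)
      by (simp add: additively_homogeneous_def inner_vec_def sum_distrib_left mult.commute)
  qed
  from this[of 1] this[of "-1"] show "(\<Sum>j\<in>UNIV. P $ i $ j) = 1"
    by simp
qed

section \<open>Final classes\<close>

lemma wf_digraph_matrix_graph: "wf_digraph (matrix_graph P)"
  by unfold_locales (auto simp: matrix_graph_def)

lemma arcs_ends_matrix_graph: "i \<rightarrow>\<^bsub>matrix_graph P\<^esub> j \<longleftrightarrow> P $ i $ j \<noteq> 0"
  by (auto simp: matrix_graph_def arcs_ends_conv image_iff)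

text \<open>Nodes of a class reach each other, and finality forbids reaching anything else. This
  form reduces questions on final classes to accessibility.\<close>

lemma (in wf_digraph) final_classes_iff:
  "C \<in> final_classes G \<longleftrightarrow> C \<noteq> {} \<and> (\<forall>i\<in>C. {j. i \<rightarrow>\<^sup>* j} = C)"
proof
  assume "C \<in> final_classes G"
  then obtain k where k: "k \<in> verts G" "C = scc_of k" and final: "\<forall>i\<in>C. \<forall>j. i \<rightarrow>\<^sup>* j \<longrightarrow> j \<in> C"
    by (auto simp: final_classes_def graph_classes_def)
  have "k \<in> C"
    using k by (simp add: in_scc_of_self)
  moreover have "i \<rightarrow>\<^sup>* j" if "i \<in> C" "j \<in> C" for i j
    using that k by (auto simp: scc_of_def intro: reachable_trans)
  ultimately show "C \<noteq> {} \<and> (\<forall>i\<in>C. {j. i \<rightarrow>\<^sup>* j} = C)"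
    using final by blast
next
  assume C: "C \<noteq> {} \<and> (\<forall>i\<in>C. {j. i \<rightarrow>\<^sup>* j} = C)"
  then obtain k where "k \<in> C" by auto
  with C have "k \<in> {j. k \<rightarrow>\<^sup>* j}" by simp
  then have "k \<in> verts G" by (simp add: reachable_in_verts)
  moreover have "C = scc_of k"
    using C \<open>k \<in> C\<close> by (auto simp: scc_of_def)
  ultimately show "C \<in> final_classes G"
    using C by (auto simp: final_classes_def graph_classes_def)
qed

lemmas final_classes_matrix_graph_iff = wf_digraph.final_classes_iff[OF wf_digraph_matrix_graph]

lemma final_class_closed:
  assumes "C \<in> final_classes (matrix_graph P)" "i \<in> C" "P $ i $ j \<noteq> 0"
  shows "j \<in> C"
proof -
  interpret wf_digraph "matrix_graph P" by (rule wf_digraph_matrix_graph)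
  have "i \<rightarrow>\<^sup>*\<^bsub>matrix_graph P\<^esub> j"
    using assms(3) by (intro reachable_adjI) (simp add: arcs_ends_matrix_graph)
  with assms show ?thesis
    by (auto simp: final_classes_matrix_graph_iff)
qed

lemma reachable_in_closed_set:
  assumes "i \<rightarrow>\<^sup>*\<^bsub>matrix_graph P\<^esub> j" "i \<in> S"
    and "\<And>i j. i \<in> S \<Longrightarrow> P $ i $ j \<noteq> 0 \<Longrightarrow> j \<in> S"
  shows "j \<in> S"
  using assms(1)
proof (induction rule: wf_digraph.reachable_induct[OF wf_digraph_matrix_graph, consumes 1])
  case 1
  show ?case by fact
next
  case (2 x y)
  then show ?case using assms(3) by (simp add: arcs_ends_matrix_graph)
qed

text \<open>
  The nodes accessible from a node of \<open>S\<close> that has access to as few nodes as possible form a final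
  class.
\<close>

lemma closed_set_contains_final_class:
  fixes P :: "real ^ 'n::finite ^ 'n"
  assumes "S \<noteq> {}" and "\<And>i j. i \<in> S \<Longrightarrow> P $ i $ j \<noteq> 0 \<Longrightarrow> j \<in> S"
  obtains C where "C \<in> final_classes (matrix_graph P)" "C \<subseteq> S"
proof -
  interpret wf_digraph "matrix_graph P" by (rule wf_digraph_matrix_graph)
  define R where "R i = {j. i \<rightarrow>\<^sup>*\<^bsub>matrix_graph P\<^esub> j}" for i
  have refl: "i \<in> R i" for i
  proof -
    have "i \<in> verts (matrix_graph P)" by (simp add: matrix_graph_def)
    then show ?thesis by (simp add: R_def)
  qed
  have trans: "R j \<subseteq> R i" if "j \<in> R i" for i j
    using that by (auto simp: R_def intro: reachable_trans)
  obtain k where k: "k \<in> S" "\<And>i. i \<in> S \<Longrightarrow> card (R k) \<le> card (R i)"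
    using assms(1) ex_has_least_nat[of "\<lambda>i. i \<in> S" _ "\<lambda>i. card (R i)"] by blast
  have sub: "R k \<subseteq> S"
  proof
    fix i
    assume "i \<in> R k"
    then have "k \<rightarrow>\<^sup>*\<^bsub>matrix_graph P\<^esub> i" by (simp add: R_def)
    then show "i \<in> S" using k(1) assms(2) by (rule reachable_in_closed_set)
  qed
  \<comment> \<open>Transitivity gives \<open>R i\<close> inside \<open>R k\<close>, and since
    \<open>i\<close> is in \<open>S\<close>, minimality of \<open>k\<close> excludes a smaller
    cardinality.\<close>
  have eq: "R i = R k" if "i \<in> R k" for i
    using that trans[OF that] k(2)[of i] sub by (intro card_seteq) auto
  then have "R k \<in> final_classes (matrix_graph P)"
    unfolding final_classes_matrix_graph_iff R_def[symmetric] using eq refl[of k]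
    by blast
  then show ?thesis using sub by (rule that)
qed

text \<open>A path that starts in \<open>C\<close> stays there, so it only sees the rows indexed by
  \<open>C\<close>; the other rows may be replaced freely.\<close>

lemma final_class_cong_rows:
  assumes C: "C \<in> final_classes (matrix_graph Q)" and rows: "\<And>i. i \<in> C \<Longrightarrow> P $ i = Q $ i"
  shows "C \<in> final_classes (matrix_graph P)"
proof -
  have mono: "i \<rightarrow>\<^sup>*\<^bsub>matrix_graph B\<^esub> j"
    if "i \<rightarrow>\<^sup>*\<^bsub>matrix_graph A\<^esub> j" "i \<in> C"
      and closed: "\<And>i j. i \<in> C \<Longrightarrow> A $ i $ j \<noteq> 0 \<Longrightarrow> j \<in> C"
      and rows: "\<And>i. i \<in> C \<Longrightarrow> A $ i = B $ i"
    for A B :: "real ^ 'a ^ 'a" and i j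
  proof -
    interpret B: wf_digraph "matrix_graph B" by (rule wf_digraph_matrix_graph)
    have "j \<in> C \<and> i \<rightarrow>\<^sup>*\<^bsub>matrix_graph B\<^esub> j"
      using that(1)
    proof (induction rule: wf_digraph.reachable_induct[OF wf_digraph_matrix_graph, consumes 1])
      case 1
      have "i \<in> verts (matrix_graph B)" by (simp add: matrix_graph_def)
      with \<open>i \<in> C\<close> show ?case by blast
    next
      case (2 x y)
      then have "y \<in> C" "x \<rightarrow>\<^bsub>matrix_graph B\<^esub> y"
        using closed rows by (auto simp: arcs_ends_matrix_graph)
      with 2 show ?case by (blast intro: B.reachable_adj_trans)
    qed
    then show ?thesis ..
  qed
  have closed: "j \<in> C" if "i \<in> C" "Q $ i $ j \<noteq> 0" for i j
    using final_class_closed[OF C] that by blast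
  have "i \<rightarrow>\<^sup>*\<^bsub>matrix_graph P\<^esub> j \<longleftrightarrow> i \<rightarrow>\<^sup>*\<^bsub>matrix_graph Q\<^esub> j" if "i \<in> C" for i j
    using mono[of P i j Q] mono[of Q i j P] that closed rows by metis
  with C show ?thesis
    by (simp add: final_classes_matrix_graph_iff)
qed

section \<open>The minimum principle\<close>

text \<open>The value of \<open>P *v z\<close> at \<open>i\<close> averages \<open>z\<close> over
  the successors of \<open>i\<close>, none below \<open>z $ i\<close>. As the average does not
  exceed \<open>z $ i\<close>, all of them equal it. Minimality is asked over successors only, so
  the step also applies to a minimum over a closed class.\<close>

lemma superharmonic_min_step:
  assumes P: "stochastic_matrix P" and "P *v z \<le> z"
    and min: "\<And>k. P $ i $ k \<noteq> 0 \<Longrightarrow> z $ i \<le> z $ k" and "P $ i $ j \<noteq> 0"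
  shows "z $ j = z $ i"
proof -
  have nonneg: "0 \<le> P $ i $ k * (z $ k - z $ i)" for k
    using P min[of k] by (cases "P $ i $ k = 0") (auto simp: stochastic_matrix_def)
  have "(\<Sum>k\<in>UNIV. P $ i $ k * (z $ k - z $ i)) = (P *v z) $ i - z $ i"
    using P by (simp add: stochastic_matrix_def matrix_vector_mult_def right_diff_distrib
        sum_subtractf flip: sum_distrib_right)
  also have "\<dots> \<le> 0"
    using \<open>P *v z \<le> z\<close> by (simp add: less_eq_vec_def)
  finally have "(\<Sum>k\<in>UNIV. P $ i $ k * (z $ k - z $ i)) = 0"
    using nonneg by (simp add: antisym sum_nonneg)
  then have "P $ i $ j * (z $ j - z $ i) = 0"
    using nonneg by (simp add: sum_nonneg_eq_0_iff)
  with assms(4) show ?thesis by simp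
qed

text \<open>The minimizers of \<open>z\<close> over \<open>C\<close> are closed under arcs, and each
  of them has access to all of \<open>C\<close>.\<close>

lemma superharmonic_const_on_final_class:
  assumes P: "stochastic_matrix P" "P *v z \<le> z"
    and C: "C \<in> final_classes (matrix_graph P)" and "i \<in> C" "j \<in> C"
  shows "z $ i = z $ j"
proof -
  define m where "m = Min ((\<lambda>k. z $ k) ` C)"
  have "m \<in> (\<lambda>k. z $ k) ` C"
    unfolding m_def using \<open>i \<in> C\<close> by (intro Min_in) auto
  then obtain k where k: "k \<in> C" "z $ k = m" by auto
  have m_le: "m \<le> z $ l" if "l \<in> C" for l
    unfolding m_def using that by (intro Min_le) auto
  have "l \<in> C \<and> z $ l = m" if "l \<in> C" for l
  proof -
    have "k \<rightarrow>\<^sup>*\<^bsub>matrix_graph P\<^esub> l"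
      using C k that by (auto simp: final_classes_matrix_graph_iff)
    then have "l \<in> {l \<in> C. z $ l = m}"
    proof (rule reachable_in_closed_set)
      fix x y
      assume x: "x \<in> {l \<in> C. z $ l = m}" and "P $ x $ y \<noteq> 0"
      have succ: "l \<in> C" if "P $ x $ l \<noteq> 0" for l
        using final_class_closed[OF C] x that by blast
      have "z $ y = z $ x"
        using P x m_le succ \<open>P $ x $ y \<noteq> 0\<close> by (intro superharmonic_min_step[of P]) auto
      with x succ \<open>P $ x $ y \<noteq> 0\<close> show "y \<in> {l \<in> C. z $ l = m}"
        by auto
    qed (use k in simp)
    then show ?thesis by simp
  qed
  with \<open>i \<in> C\<close> \<open>j \<in> C\<close> show ?thesis by simp
qed

text \<open>The global minimizers of \<open>z\<close> form a nonempty set closed under arcs, and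
  such a set contains a final class.\<close>

lemma superharmonic_min_on_final_class:
  fixes P :: "real ^ 'n::finite ^ 'n"
  assumes P: "stochastic_matrix P" "P *v z \<le> z"
  obtains C where "C \<in> final_classes (matrix_graph P)" "\<And>i j. i \<in> C \<Longrightarrow> z $ i \<le> z $ j"
proof -
  define S where "S = {i. \<forall>j. z $ i \<le> z $ j}"
  have "Min (range (\<lambda>k. z $ k)) \<in> range (\<lambda>k. z $ k)"
    by (intro Min_in) auto
  then obtain k where "z $ k = Min (range (\<lambda>k. z $ k))" by (metis imageE)
  then have "k \<in> S"
    by (simp add: S_def)
  then have "S \<noteq> {}" by blast
  moreover have "j \<in> S" if "i \<in> S" "P $ i $ j \<noteq> 0" for i j
    using superharmonic_min_step[OF P, of i j] that by (simp add: S_def)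
  ultimately obtain C where "C \<in> final_classes (matrix_graph P)" "C \<subseteq> S"
    using closed_set_contains_final_class by metis
  then show ?thesis
    by (intro that[of C]) (auto simp: S_def)
qed

section \<open>Eigenvectors and the critical graph\<close>

text \<open>Shift \<open>w\<close> by a constant until it lies above \<open>v\<close> and touches it
  at a coordinate \<open>k\<close>; applying \<open>f\<close> keeps the order, and coordinate
  \<open>k\<close> compares the eigenvalues.\<close>

lemma eigenvalue_le:
  fixes f :: "real ^ 'n::finite \<Rightarrow> real ^ 'n"
  assumes "mono f" "additively_homogeneous f" and v: "f v = vec l + v" and w: "f w = vec m + w"
  shows "l \<le> m"
proof -
  define t where "t = Max (range (\<lambda>i. v $ i - w $ i))"
  have "t \<in> range (\<lambda>i. v $ i - w $ i)"
    unfolding t_def by (intro Max_in) auto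
  then obtain k where k: "t = v $ k - w $ k" by auto
  have "v $ i - w $ i \<le> t" for i
    unfolding t_def by (intro Max_ge) auto
  then have "v \<le> vec t + w"
    by (simp add: less_eq_vec_def algebra_simps)
  then have "f v \<le> vec t + f w"
    using assms(1,2) by (metis monoD additively_homogeneous_def)
  then have "f v $ k \<le> t + f w $ k"
    by (simp add: less_eq_vec_def)
  then show ?thesis
    by (simp add: v w k)
qed

lemma eigenvectors_common_eigenvalue:
  assumes "mono f" "additively_homogeneous f" "eigenvector f v" "eigenvector f w"
  obtains l where "f v = vec l + v" "f w = vec l + w"
proof -
  obtain l m where lm: "f v = vec l + v" "f w = vec m + w"
    using assms(3,4) by (auto simp: eigenvector_def)
  then have "l = m"
    using eigenvalue_le[OF assms(1,2)] by (intro order_antisym) auto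
  with lm show ?thesis by (intro that) auto
qed

text \<open>The eigenvalues agree, so \<open>f v - f w = v - w\<close>, and the subgradient
  inequality at \<open>w\<close> is tested at \<open>v\<close>.\<close>

lemma eigenvector_diff_superharmonic:
  assumes "mono f" "additively_homogeneous f" "eigenvector f v" "eigenvector f w"
    and "P \<in> subdifferential f w"
  shows "P *v (v - w) \<le> v - w"
proof -
  obtain l where "f v = vec l + v" "f w = vec l + w"
    using eigenvectors_common_eigenvalue assms by blast
  then have "f v - f w = v - w" by simp
  with assms(5) show ?thesis
    by (auto simp: subdifferential_def dest: spec[of _ v])
qed

lemma verts_critical_graph:
  "verts (critical_graph f w) = (\<Union>P\<in>subdifferential f w. \<Union> (final_classes (matrix_graph P)))"
  by (simp add: critical_graph_def final_graph_def)

text \<open>One half of the independence of the critical graph from the eigenvector.\<close>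

lemma final_class_subset_critical:
  fixes f :: "real ^ 'n::finite \<Rightarrow> real ^ 'n"
  assumes f: "coordinatewise_convex f" "mono f" "additively_homogeneous f"
    and vw: "eigenvector f v" "eigenvector f w"
    and Q: "Q \<in> subdifferential f v" and C: "C \<in> final_classes (matrix_graph Q)"
  shows "C \<subseteq> verts (critical_graph f w)"
proof -
  obtain P0 where P0: "P0 \<in> subdifferential f w"
    using subdifferential_nonempty f(1) by blast
  obtain l where l: "f v = vec l + v" "f w = vec l + w"
    using eigenvectors_common_eigenvalue f vw by blast
  have sto: "stochastic_matrix Q"
    using subdifferential_stochastic f Q by blast
  \<comment> \<open>Only the rows of \<open>Q\<close> in \<open>C\<close> are known to remain
    subgradients at \<open>w\<close>; the others are filled from an arbitrary element
    \<open>P0\<close>.\<close>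
  define P where "P = (\<chi> i. if i \<in> C then Q $ i else P0 $ i)"
  \<comment> \<open>Row \<open>i\<close> of \<open>Q\<close> is supported in \<open>C\<close>, where
    \<open>w - v\<close> is constant, and sums to 1. Moving the base point from \<open>v\<close> to
    \<open>w\<close> thus changes both sides by the same amount.\<close>
  have "Q $ i \<bullet> (x - w) \<le> f x $ i - f w $ i" if "i \<in> C" for i x
  proof -
    have "(w - v) $ j = (w - v) $ i" if "j \<in> C" for j
      using superharmonic_const_on_final_class[OF sto _ C]
        eigenvector_diff_superharmonic[OF f(2,3) vw(2,1) Q] that \<open>i \<in> C\<close> by blast
    then have "Q $ i $ j * (w - v) $ j = Q $ i $ j * (w - v) $ i" for j
      using final_class_closed[OF C \<open>i \<in> C\<close>, of j] by (cases "Q $ i $ j = 0") simp_all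
    then have "Q $ i \<bullet> (w - v) = (\<Sum>j\<in>UNIV. Q $ i $ j) * (w - v) $ i"
      unfolding inner_vec_def sum_distrib_right inner_real_def by (intro sum.cong refl)
    also have "\<dots> = w $ i - v $ i"
      using sto by (simp add: stochastic_matrix_def)
    finally have "Q $ i \<bullet> (w - v) = w $ i - v $ i" .
    moreover have "Q $ i \<bullet> (x - v) \<le> f x $ i - f v $ i"
      using Q by (simp add: subdifferential_iff_rows)
    ultimately show ?thesis
      by (simp add: l inner_diff_right)
  qed
  with P0 have "P \<in> subdifferential f w"
    by (simp add: subdifferential_iff_rows P_def)
  moreover have "C \<in> final_classes (matrix_graph P)"
    using C by (rule final_class_cong_rows) (simp add: P_def)
  ultimately show ?thesis
    by (auto simp: verts_critical_graph)
qed

text \<open>Each arc of the path lies in a final class of some \<open>P\<close>, where the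
  difference is constant; \<open>P\<close> may vary from arc to arc.\<close>

lemma critical_graph_reachable_const:
  fixes f :: "real ^ 'n::finite \<Rightarrow> real ^ 'n"
  assumes f: "mono f" "additively_homogeneous f"
    and vw: "eigenvector f v" "eigenvector f w"
    and reach: "i \<rightarrow>\<^sup>*\<^bsub>critical_graph f w\<^esub> j"
  shows "(v - w) $ i = (v - w) $ j"
  using reach
proof (induction rule: wf_digraph.reachable_induct[OF wf_digraph_critical_graph, consumes 1])
  case 1
  show ?case ..
next
  case (2 x y)
  then obtain P where P: "P \<in> subdifferential f w" and arc: "(x, y) \<in> arcs (final_graph P)"
    by (auto simp: critical_graph_def arcs_ends_conv)
  then obtain C where C: "C \<in> final_classes (matrix_graph P)" "x \<in> C" and "P $ x $ y \<noteq> 0"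
    by (auto simp: final_graph_def matrix_graph_def induce_subgraph_def)
  then have "y \<in> C"
    using final_class_closed by blast
  then have "(v - w) $ x = (v - w) $ y"
    using superharmonic_const_on_final_class[OF _ _ C] subdifferential_stochastic[OF f P]
      eigenvector_diff_superharmonic[OF f vw P] by blast
  with 2 show ?case by simp
qed

lemma reachable_if_unique_critical_class:
  assumes "\<exists>!C. C \<in> critical_classes f w"
    and "i \<in> verts (critical_graph f w)" "j \<in> verts (critical_graph f w)"
  shows "i \<rightarrow>\<^sup>*\<^bsub>critical_graph f w\<^esub> j"
proof -
  interpret wf_digraph "critical_graph f w" by (rule wf_digraph_critical_graph)
  have "critical_classes f w = scc_of ` verts (critical_graph f w)"
    by (simp add: critical_classes_def flip: sccs_verts_conv sccs_verts_conv_scc_of)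
  with assms have "scc_of i = scc_of j" by blast
  with assms show ?thesis
    using in_scc_of_self[of j] by (auto simp: scc_of_def)
qed

lemma eigenvector_diff_const:
  fixes f :: "real ^ 'n::finite \<Rightarrow> real ^ 'n"
  assumes f: "coordinatewise_convex f" "mono f" "additively_homogeneous f"
    and vw: "eigenvector f v" "eigenvector f w"
    and unique: "\<exists>!C. C \<in> critical_classes f w"
  obtains c where "v = vec c + w"
proof -
  obtain P Q where P: "P \<in> subdifferential f w" and Q: "Q \<in> subdifferential f v"
    using subdifferential_nonempty f(1) by blast
  obtain C where C: "C \<in> final_classes (matrix_graph P)"
    and C_min: "\<And>i j. i \<in> C \<Longrightarrow> (v - w) $ i \<le> (v - w) $ j"
    using superharmonic_min_on_final_class subdifferential_stochastic[OF f(2,3) P]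
      eigenvector_diff_superharmonic[OF f(2,3) vw P] by blast
  \<comment> \<open>Subgradients at \<open>w\<close> control only minima of \<open>v - w\<close>;
    its maxima are reached as minima of \<open>w - v\<close>, through subgradients at
    \<open>v\<close>.\<close>
  obtain D where D: "D \<in> final_classes (matrix_graph Q)"
    and D_min: "\<And>i j. i \<in> D \<Longrightarrow> (w - v) $ i \<le> (w - v) $ j"
    using superharmonic_min_on_final_class subdifferential_stochastic[OF f(2,3) Q]
      eigenvector_diff_superharmonic[OF f(2,3) vw(2,1) Q] by blast
  obtain a b where ab: "a \<in> C" "b \<in> D"
    using C D by (auto simp: final_classes_matrix_graph_iff)
  have "a \<in> verts (critical_graph f w)" "b \<in> verts (critical_graph f w)"
    using ab P C final_class_subset_critical[OF f vw Q D] unfolding verts_critical_graph by blast+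
  then have "(v - w) $ a = (v - w) $ b"
    using critical_graph_reachable_const[OF f(2,3) vw]
      reachable_if_unique_critical_class[OF unique] by blast
  moreover have "(v - w) $ a \<le> (v - w) $ j" "(v - w) $ j \<le> (v - w) $ b" for j
    using C_min[OF ab(1), of j] D_min[OF ab(2), of j] by simp_all
  ultimately have "(v - w) $ j = (v - w) $ a" for j
    by (metis order_antisym)
  then have "v = vec ((v - w) $ a) + w"
    by (simp add: vec_eq_iff algebra_simps)
  then show ?thesis by (rule that)
qed

theorem theorem3p1:
  fixes f :: "real ^ 'n::finite \<Rightarrow> real ^ 'n" and w :: "real ^ 'n"
  assumes "coordinatewise_convex f"
    and "mono f"
    and "additively_homogeneous f"
    and "eigenvector f w"
    and "\<exists>!C. C \<in> critical_classes f w"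
  shows "\<forall>v v'. eigenvector f v \<and> eigenvector f v' \<longrightarrow> (\<exists>\<mu>. v' = vec \<mu> + v)"
proof (intro allI impI)
  fix v v'
  assume "eigenvector f v \<and> eigenvector f v'"
  \<comment> \<open>Both eigenvectors are compared with \<open>w\<close>, where the critical graph
    is formed.\<close>
  then obtain c c' where "v = vec c + w" "v' = vec c' + w"
    using eigenvector_diff_const[OF assms(1-3) _ assms(4,5)] by metis
  then have "v' = vec (c' - c) + v"
    by (simp add: vec_eq_iff)
  then show "\<exists>\<mu>. v' = vec \<mu> + v" ..
qed

end
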